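(* Let $P=\frac15P_1+\frac45P_2$, where $P_1$ and $P_2$ are the uniform distributions on $[0,1]$ and $[1,2]$, respectively. The set $\{0.400679,\ 1.202036,\ 1.734012\}$ forms an optimal set of three-means for $P$ with quantization error $V_3=0.0295695$, where the displayed decimals are roundings of exact real values; that is, there is an optimal set of three-means $\{a_1<a_2<a_3\}$ for $P$ such that $a_1,a_2,a_3$ rounded to six decimal places are $0.400679$, $1.202036$, $1.734012$, and $V_3$ rounded to seven decimal places is $0.0295695$.
   Context: For a Borel probability measure $P$ on $\mathbb{R}$ and $n\in\mathbb{N}$, the $n$th quantization error is $V_n=V_n(P)=\inf\{\int\min_{a\in\alpha}(x-a)^2\,dP(x) : \alpha\subset\mathbb{R},\ 1\le\mathrm{card}(\alpha)\le n\}$, and an optimal set of $n$-means for $P$ is a set $\alpha$ with $1\le\mathrm{card}(\alpha)\le n$ attaining this infimum. *)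

theory Defs
  imports "HOL-Probability.Probability"
begin

text \<open>
  The integrals are nonnegative Lebesgue integrals with values in \<^typ>\<open>ennreal\<close>, so a measure
  without a finite second moment gets infinite distortion, where the Bochner integral would be 0.
\<close>

definition distortion :: "real measure \<Rightarrow> real set \<Rightarrow> ennreal" where
  "distortion P \<alpha> = (\<integral>\<^sup>+ x. ennreal (MIN a\<in>\<alpha>. (x - a)\<^sup>2) \<partial>P)"

text \<open>
  \<^term>\<open>card \<alpha> = 0\<close> for infinite \<open>\<alpha>\<close>, hence \<^prop>\<open>1 \<le> card \<alpha>\<close> forces \<open>\<alpha>\<close> to be finite and nonempty.
\<close>

definition quantization_error :: "real measure \<Rightarrow> nat \<Rightarrow> ennreal" where
  "quantization_error P n = (INF \<alpha>\<in>{\<alpha>. 1 \<le> card \<alpha> \<and> card \<alpha> \<le> n}. distortion P \<alpha>)"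

definition optimal_set_of_means :: "real measure \<Rightarrow> nat \<Rightarrow> real set \<Rightarrow> bool" where
  "optimal_set_of_means P n \<alpha> \<longleftrightarrow>
     1 \<le> card \<alpha> \<and> card \<alpha> \<le> n \<and> distortion P \<alpha> = quantization_error P n"

definition add_measure :: "'a measure \<Rightarrow> 'a measure \<Rightarrow> 'a measure" where
  "add_measure M N = measure_of (space M) (sets M) (\<lambda>A. emeasure M A + emeasure N A)"

lemma space_add_measure [simp]: "space (add_measure M N) = space M"
  by (simp add: add_measure_def)

lemma sets_add_measure [simp, measurable_cong]: "sets (add_measure M N) = sets M"
  by (simp add: add_measure_def)

lemma emeasure_add_measure:
  assumes "sets N = sets M" and "A \<in> sets M"
  shows "emeasure (add_measure M N) A = emeasure M A + emeasure N A"
proof (rule emeasure_measure_of[OF add_measure_def])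
  show "sets M \<subseteq> Pow (space M)" by (rule sets.space_closed)
  show "A \<in> sets (add_measure M N)" using assms(2) by simp
  show "positive (sets (add_measure M N)) (\<lambda>A. emeasure M A + emeasure N A)"
    by (simp add: positive_def)
  show "countably_additive (sets (add_measure M N)) (\<lambda>A. emeasure M A + emeasure N A)"
  proof (rule countably_additiveI)
    fix F :: "nat \<Rightarrow> 'a set"
    assume F: "range F \<subseteq> sets (add_measure M N)" "disjoint_family F"
    have "(\<Sum>i. emeasure M (F i) + emeasure N (F i))
        = (\<Sum>i. emeasure M (F i)) + (\<Sum>i. emeasure N (F i))"
      by (rule suminf_add[symmetric]) auto
    also have "\<dots> = emeasure M (\<Union>i. F i) + emeasure N (\<Union>i. F i)"
      using F assms(1) by (simp add: suminf_emeasure)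
    finally show "(\<Sum>i. emeasure M (F i) + emeasure N (F i))
        = emeasure M (\<Union>i. F i) + emeasure N (\<Union>i. F i)" .
  qed
qed

definition P_mix :: "real measure" where
  "P_mix = add_measure (scale_measure (1/5) (uniform_measure lborel {0..1}))
                       (scale_measure (4/5) (uniform_measure lborel {1..2}))"

lemma sets_P_mix [simp, measurable_cong]: "sets P_mix = sets borel"
  by (simp add: P_mix_def)

lemma emeasure_P_mix:
  assumes "A \<in> sets borel"
  shows "emeasure P_mix A = 1/5 * emeasure (uniform_measure lborel {0..1}) A
                          + 4/5 * emeasure (uniform_measure lborel {1..2}) A"
  using assms by (simp add: P_mix_def emeasure_add_measure)

lemma prob_space_P_mix: "prob_space P_mix"
proof
  have *: "(1/5 :: ennreal) + 4/5 = 1"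
    by (simp add: add_divide_distrib_ennreal[symmetric] ennreal_divide_self)
  have "space P_mix = UNIV"
    by (simp add: P_mix_def space_scale_measure)
  then show "emeasure P_mix (space P_mix) = 1"
    using * by (simp add: emeasure_P_mix ennreal_divide_self)
qed

end

theory Submission
  imports Defs
begin

text \<open>
  The measure has density 1/5 on [0,1] and 4/5 on [1,2], so the distortion of a set
  \<open>{a, b, c}\<close> with \<open>a \<le> b \<le> c\<close> is a piecewise cubic function of three variables. What makes its
  global minimum accessible is that the middle point \<open>b\<close> separates the outer points: given \<open>b\<close>,
  the choice of \<open>a\<close> matters only to the left of \<open>b\<close> and the choice of \<open>c\<close> only to the right.
  On an interval of length \<open>L\<close> with Lebesgue measure and one prescribed point at an endpoint, the
  best second point lies at distance \<open>2 L / 3\<close> from that endpoint and leaves the error \<open>L^3 / 27\<close>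
  (\<open>integral_min_left_end_ge\<close>, \<open>integral_min_right_end_ge\<close>).

  Assume first that \<open>1 \<le> b \<le> 2\<close> and that the cell of \<open>a\<close> ends at or before 1. Then all of [1,b] is served
  by \<open>b\<close>, so the excess weight 3/5 carried by this interval costs exactly \<open>(b - 1)^3 / 5\<close>. Adding the
  two one-sided bounds, for weight 1/5 on [0,b] and 4/5 on [b,2], bounds the distortion below by
  \<open>b^3 / 135 + (b - 1)^3 / 5 + 4 (2 - b)^3 / 135\<close>, a cubic in \<open>b\<close> alone. Its derivative
  vanishes where \<open>24 b^2 - 38 b + 11 = 0\<close>, and its minimum over \<open>b \<ge> 0\<close> is at
  \<open>b = (19 + sqrt 97) / 24\<close>. There the bound is attained with \<open>a = b / 3\<close> and \<open>c = (b + 4) / 3\<close>, and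
  the value is about 0.02956946.

  The other positions of the points lose. If \<open>b \<le> 1\<close>, then the part of the measure on [1,2] alone
  costs at least 4/135, about 0.02963, just above the minimum
  (\<open>mix_distortion3_ge_one_right\<close>). If the cell of \<open>a\<close> extends beyond 1, the cost is at least 1/30
  (\<open>mix_distortion3_ge_left_cell_beyond_1\<close>). Points to the right of 2 may be moved to 2 beforehand.
\<close>

section \<open>Integrals with respect to the mixture\<close>

lemma P_mix_eq_density:
  "P_mix = density lborel (\<lambda>x. 1/5 * indicator {0..1} x + 4/5 * indicator {1..2} x)"
proof (rule measure_eqI)
  show "sets P_mix = sets (density lborel (\<lambda>x. 1/5 * indicator {0..1} x + 4/5 * indicator {1..2::real} x))"
    by simp
next
  fix A assume "A \<in> sets P_mix"
  then have A [measurable]: "A \<in> sets borel" by simp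
  have "emeasure (density lborel (\<lambda>x. 1/5 * indicator {0..1} x + 4/5 * indicator {1..2::real} x)) A
      = (\<integral>\<^sup>+ x. (1/5 * indicator {0..1} x + 4/5 * indicator {1..2} x) * indicator A x \<partial>lborel)"
    by (subst emeasure_density) auto
  also have "\<dots> = (\<integral>\<^sup>+ x. 1/5 * indicator ({0..1} \<inter> A) x + 4/5 * indicator ({1..2} \<inter> A) x \<partial>lborel)"
    by (intro nn_integral_cong) (auto split: split_indicator)
  also have "\<dots> = 1/5 * emeasure lborel ({0..1} \<inter> A) + 4/5 * emeasure lborel ({1..2} \<inter> A)"
    by (subst nn_integral_add) (auto simp: nn_integral_cmult)
  also have "\<dots> = emeasure P_mix A"
    using A by (simp add: emeasure_P_mix divide_ennreal_def)
  finally show "emeasure P_mix A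
      = emeasure (density lborel (\<lambda>x. 1/5 * indicator {0..1} x + 4/5 * indicator {1..2} x)) A"
    by simp
qed

lemma nn_integral_Icc_continuous:
  fixes h :: "real \<Rightarrow> real"
  assumes "continuous_on UNIV h" and "\<And>x. 0 \<le> h x"
  shows "(\<integral>\<^sup>+ x. ennreal (h x) * indicator {l..r} x \<partial>lborel) = ennreal (integral {l..r} h)"
proof -
  have "continuous_on {l..r} h"
    using assms(1) continuous_on_subset by blast
  then have "(h has_integral integral {l..r} h) {l..r}"
    by (intro integrable_integral integrable_continuous_real)
  then show ?thesis
    using assms(2) by (intro nn_integral_has_integral_lebesgue') auto
qed

lemma nn_integral_P_mix:
  fixes h :: "real \<Rightarrow> real"
  assumes cont: "continuous_on UNIV h" and pos: "\<And>x. 0 \<le> h x"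
  shows "(\<integral>\<^sup>+ x. ennreal (h x) \<partial>P_mix)
       = ennreal (1/5 * integral {0..1} h + 4/5 * integral {1..2} h)"
proof -
  have [measurable]: "h \<in> borel_measurable borel"
    using cont by (rule borel_measurable_continuous_onI)
  have int_pos: "0 \<le> integral {l..r} h" for l r
    using cont pos
    by (intro integral_nonneg integrable_continuous_real) (auto intro: continuous_on_subset)
  have "(\<integral>\<^sup>+ x. ennreal (h x) \<partial>P_mix)
      = (\<integral>\<^sup>+ x. (1/5 * indicator {0..1} x + 4/5 * indicator {1..2} x) * ennreal (h x) \<partial>lborel)"
    unfolding P_mix_eq_density by (subst nn_integral_density) auto
  also have "\<dots> = (\<integral>\<^sup>+ x. 1/5 * (ennreal (h x) * indicator {0..1} x)
                       + 4/5 * (ennreal (h x) * indicator {1..2} x) \<partial>lborel)"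
    by (intro nn_integral_cong) (simp add: distrib_left distrib_right mult_ac)
  also have "\<dots> = 1/5 * ennreal (integral {0..1} h) + 4/5 * ennreal (integral {1..2} h)"
    by (subst nn_integral_add)
       (auto simp: nn_integral_cmult nn_integral_Icc_continuous[OF cont pos])
  also have "(1/5 :: ennreal) = ennreal (1/5)"
    by (metis divide_ennreal ennreal_1 ennreal_numeral zero_le_numeral zero_le_one zero_less_numeral)
  also have "(4/5 :: ennreal) = ennreal (4/5)"
    by (metis divide_ennreal ennreal_numeral zero_le_numeral zero_less_numeral)
  finally show ?thesis
    using int_pos by (simp add: ennreal_mult[symmetric] ennreal_plus[symmetric] del: ennreal_plus)
qed

section \<open>Least mean square error on an interval\<close>

lemma square_dist_le_midpoint:
  fixes a b x :: real
  assumes "a \<le> b"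
  shows "x \<le> (a + b) / 2 \<Longrightarrow> (x - a)\<^sup>2 \<le> (x - b)\<^sup>2"
    and "(a + b) / 2 \<le> x \<Longrightarrow> (x - b)\<^sup>2 \<le> (x - a)\<^sup>2"
proof -
  have *: "(x - b)\<^sup>2 = (x - a)\<^sup>2 + (b - a) * (a + b - 2 * x)"
    by (simp add: power2_eq_square algebra_simps)
  show "(x - a)\<^sup>2 \<le> (x - b)\<^sup>2" if "x \<le> (a + b) / 2"
    unfolding * using that assms by simp
  show "(x - b)\<^sup>2 \<le> (x - a)\<^sup>2" if "(a + b) / 2 \<le> x"
    unfolding * using that assms by (simp add: mult_nonneg_nonpos)
qed

lemma integral_square_dist:
  fixes l r a :: real
  assumes "l \<le> r"
  shows "integral {l..r} (\<lambda>x. (x - a)\<^sup>2) = ((r - a)^3 - (l - a)^3) / 3"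
proof (rule integral_unique)
  have "((\<lambda>x. (x - a)\<^sup>2) has_integral ((r - a)^3 / 3 - (l - a)^3 / 3)) {l..r}"
    using assms
    by (intro fundamental_theorem_of_calculus)
       (auto intro!: derivative_eq_intros
             simp flip: has_real_derivative_iff_has_vector_derivative)
  then show "((\<lambda>x. (x - a)\<^sup>2) has_integral ((r - a)^3 - (l - a)^3) / 3) {l..r}"
    by (simp add: diff_divide_distrib)
qed

text \<open>
The best single point is the centre of the interval; the integral about any other point exceeds
the variance term by the length times the squared distance to the centre.
\<close>

lemma integral_square_dist_ge:
  fixes l r a :: real
  assumes "l \<le> r"
  shows "(r - l)^3 / 12 \<le> integral {l..r} (\<lambda>x. (x - a)\<^sup>2)"
proof -
  have "((r - a)^3 - (l - a)^3) / 3 - (r - l)^3 / 12 = (r - l) * ((l + r) / 2 - a)\<^sup>2"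
    by (simp add: power2_eq_square power3_eq_cube field_simps)
  also have "\<dots> \<ge> 0" using assms by simp
  finally show ?thesis using assms by (simp add: integral_square_dist)
qed

text \<open>
The cells of two points meet at their midpoint, so \<open>s\<close> is the midpoint clamped to the interval; when it
lies outside, one of the two cells is empty.
\<close>

lemma integral_min_square_dist_split:
  fixes l r a b :: real
  assumes "l \<le> r" "a \<le> b"
  obtains s where "l \<le> s" "s \<le> r"
    "integral {l..r} (\<lambda>x. min ((x - a)\<^sup>2) ((x - b)\<^sup>2))
     = integral {l..s} (\<lambda>x. (x - a)\<^sup>2) + integral {s..r} (\<lambda>x. (x - b)\<^sup>2)"
proof
  define s where "s = max l (min r ((a + b) / 2))"
  show s: "l \<le> s" "s \<le> r" using assms by (auto simp: s_def)
  have "integral {l..r} (\<lambda>x. min ((x - a)\<^sup>2) ((x - b)\<^sup>2))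
      = integral {l..s} (\<lambda>x. min ((x - a)\<^sup>2) ((x - b)\<^sup>2))
        + integral {s..r} (\<lambda>x. min ((x - a)\<^sup>2) ((x - b)\<^sup>2))"
    using s by (intro Henstock_Kurzweil_Integration.integral_combine[symmetric]
                      integrable_continuous_real continuous_intros) auto
  also have "integral {l..s} (\<lambda>x. min ((x - a)\<^sup>2) ((x - b)\<^sup>2)) = integral {l..s} (\<lambda>x. (x - a)\<^sup>2)"
  proof (cases "l < s")
    case True
    then have "s \<le> (a + b) / 2" by (auto simp: s_def max_def min_def split: if_splits)
    then show ?thesis
      using assms by (intro integral_cong min_absorb1 square_dist_le_midpoint(1)) auto
  next
    case False
    then have "s = l" using s by simp
    then show ?thesis by simp
  qed
  also have "integral {s..r} (\<lambda>x. min ((x - a)\<^sup>2) ((x - b)\<^sup>2)) = integral {s..r} (\<lambda>x. (x - b)\<^sup>2)"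
  proof (cases "s < r")
    case True
    then have "(a + b) / 2 \<le> s" by (auto simp: s_def max_def min_def split: if_splits)
    then show ?thesis
      using assms by (intro integral_cong min_absorb2 square_dist_le_midpoint(2)) auto
  next
    case False
    then have "s = r" using s by simp
    then show ?thesis by simp
  qed
  finally show "integral {l..r} (\<lambda>x. min ((x - a)\<^sup>2) ((x - b)\<^sup>2))
     = integral {l..s} (\<lambda>x. (x - a)\<^sup>2) + integral {s..r} (\<lambda>x. (x - b)\<^sup>2)" .
qed

text \<open>
The lengths \<open>y\<close> and \<open>z\<close> are those of the cells of two points in an interval. A cell of length \<open>y\<close>
costs at least \<open>y^3 / 12\<close> if its point is free; a cell of length \<open>z\<close> costs \<open>z^3 / 3\<close> if its point is
its endpoint. The inequalities are tight at \<open>y = z\<close> and \<open>y = 2 * z\<close> respectively, hence the square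
factors in the proof.
\<close>

lemma sum_of_cubes_ge:
  fixes y z :: real
  assumes "0 \<le> y" "0 \<le> z"
  shows "(y + z)^3 / 48 \<le> y^3 / 12 + z^3 / 12"
    and "(y + z)^3 / 27 \<le> y^3 / 12 + z^3 / 3"
proof -
  have "y^3 / 12 + z^3 / 12 - (y + z)^3 / 48 = (y + z) * (y - z)\<^sup>2 / 16"
    by (simp add: power2_eq_square power3_eq_cube field_simps)
  also have "\<dots> \<ge> 0" using assms by simp
  finally show "(y + z)^3 / 48 \<le> y^3 / 12 + z^3 / 12" by simp
  have "y^3 / 12 + z^3 / 3 - (y + z)^3 / 27 = (y - 2 * z)\<^sup>2 * (5 * y + 8 * z) / 108"
    by (simp add: power2_eq_square power3_eq_cube field_simps)
  also have "\<dots> \<ge> 0" using assms by simp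
  finally show "(y + z)^3 / 27 \<le> y^3 / 12 + z^3 / 3" by simp
qed

lemma integral_min_two_free_ge:
  fixes l r a b :: real
  assumes "l \<le> r" "a \<le> b"
  shows "(r - l)^3 / 48 \<le> integral {l..r} (\<lambda>x. min ((x - a)\<^sup>2) ((x - b)\<^sup>2))"
proof -
  obtain s where s: "l \<le> s" "s \<le> r" and eq: "integral {l..r} (\<lambda>x. min ((x - a)\<^sup>2) ((x - b)\<^sup>2))
     = integral {l..s} (\<lambda>x. (x - a)\<^sup>2) + integral {s..r} (\<lambda>x. (x - b)\<^sup>2)"
    using integral_min_square_dist_split[OF assms] .
  show ?thesis
    using integral_square_dist_ge[OF s(1), of a] integral_square_dist_ge[OF s(2), of b]
      sum_of_cubes_ge(1)[of "s - l" "r - s"] s eq by simp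
qed

lemma integral_min_right_end_ge:
  fixes l r a :: real
  assumes "l \<le> r" "a \<le> r"
  shows "(r - l)^3 / 27 \<le> integral {l..r} (\<lambda>x. min ((x - a)\<^sup>2) ((x - r)\<^sup>2))"
proof -
  obtain s where s: "l \<le> s" "s \<le> r" and eq: "integral {l..r} (\<lambda>x. min ((x - a)\<^sup>2) ((x - r)\<^sup>2))
     = integral {l..s} (\<lambda>x. (x - a)\<^sup>2) + integral {s..r} (\<lambda>x. (x - r)\<^sup>2)"
    using integral_min_square_dist_split[OF assms] .
  have "integral {s..r} (\<lambda>x. (x - r)\<^sup>2) = (r - s)^3 / 3"
    using s by (simp add: integral_square_dist power3_eq_cube algebra_simps)
  then show ?thesis
    using integral_square_dist_ge[OF s(1), of a] sum_of_cubes_ge(2)[of "s - l" "r - s"] s eq by simp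
qed

lemma integral_min_left_end_ge:
  fixes l r c :: real
  assumes "l \<le> r" "l \<le> c"
  shows "(r - l)^3 / 27 \<le> integral {l..r} (\<lambda>x. min ((x - l)\<^sup>2) ((x - c)\<^sup>2))"
proof -
  obtain s where s: "l \<le> s" "s \<le> r" and eq: "integral {l..r} (\<lambda>x. min ((x - l)\<^sup>2) ((x - c)\<^sup>2))
     = integral {l..s} (\<lambda>x. (x - l)\<^sup>2) + integral {s..r} (\<lambda>x. (x - c)\<^sup>2)"
    using integral_min_square_dist_split[OF assms] .
  have "integral {l..s} (\<lambda>x. (x - l)\<^sup>2) = (s - l)^3 / 3"
    using s by (simp add: integral_square_dist)
  then show ?thesis
    using integral_square_dist_ge[OF s(2), of c] sum_of_cubes_ge(2)[of "r - s" "s - l"] s eq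
    by simp
qed

section \<open>The distortion of three points\<close>

definition min_sq :: "real \<Rightarrow> real \<Rightarrow> real \<Rightarrow> real \<Rightarrow> real" where
  "min_sq a b c x = min ((x - a)\<^sup>2) (min ((x - b)\<^sup>2) ((x - c)\<^sup>2))"

lemma min_sq_le: "z \<in> {a, b, c} \<Longrightarrow> min_sq a b c x \<le> (x - z)\<^sup>2"
  by (auto simp: min_sq_def)

lemma continuous_on_min_sq: "continuous_on S (min_sq a b c)"
  unfolding min_sq_def by (intro continuous_intros)

lemma integrable_min_sq: "min_sq a b c integrable_on {l..r}"
  by (intro integrable_continuous_real continuous_on_min_sq)

lemma integrable_min2: "(\<lambda>x. min ((x - a)\<^sup>2) ((x - b)\<^sup>2)) integrable_on {l..r::real}"
  by (intro integrable_continuous_real continuous_intros)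

lemma integrable_sq: "(\<lambda>x. (x - a)\<^sup>2) integrable_on {l..r::real}"
  by (intro integrable_continuous_real continuous_intros)

lemma integral_min_sq_combine:
  "l \<le> s \<Longrightarrow> s \<le> r \<Longrightarrow>
   integral {l..r} (min_sq a b c) = integral {l..s} (min_sq a b c) + integral {s..r} (min_sq a b c)"
  by (simp add: Henstock_Kurzweil_Integration.integral_combine integrable_min_sq)

text \<open>
A set of one or two points is written as a triple by repeating points, so every competitor has this form.
\<close>

definition mix_distortion3 :: "real \<Rightarrow> real \<Rightarrow> real \<Rightarrow> real" where
  "mix_distortion3 a b c
   = 1/5 * integral {0..1} (min_sq a b c) + 4/5 * integral {1..2} (min_sq a b c)"

lemma distortion_P_mix:
  "distortion P_mix {a, b, c} = ennreal (mix_distortion3 a b c)"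
proof -
  have "(MIN a'\<in>{a, b, c}. (x - a')\<^sup>2) = min_sq a b c x" for x
    by (simp add: min_sq_def)
  then show ?thesis
    unfolding distortion_def mix_distortion3_def
    using nn_integral_P_mix[OF continuous_on_min_sq, of a b c] by (simp add: min_sq_def)
qed

section \<open>The cubic in the middle point\<close>

text \<open>
The terms are the cost of [0,b] at density 1/5 with a best left point, the cost of the extra density
3/5 on [1,b] when \<open>b\<close> serves it, and the cost of [b,2] at density 4/5 with a best right point.
\<close>

definition middle_bound :: "real \<Rightarrow> real" where
  "middle_bound b = b^3 / 135 + (b - 1)^3 / 5 + 4 * (2 - b)^3 / 135"

text \<open>
The larger critical point of \<^const>\<open>middle_bound\<close>, where this cubic has its local minimum.
\<close>

definition b_opt :: real where
  "b_opt = (19 + sqrt 97) / 24"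

lemma sqrt_97_bounds: "9.848857 < sqrt 97" "sqrt 97 < 9.848858"
  by (rule real_less_rsqrt, simp add: power2_eq_square)
     (rule real_less_lsqrt, simp_all add: power2_eq_square)

lemma b_opt_bounds: "1.2020357 < b_opt" "b_opt < 1.2020358"
  using sqrt_97_bounds by (simp_all add: b_opt_def)

lemma b_opt_root: "24 * b_opt\<^sup>2 = 38 * b_opt - 11"
  by (simp add: b_opt_def power2_eq_square field_simps)

lemma middle_bound_expand: "135 * middle_bound b = 24 * b^3 - 57 * b\<^sup>2 + 33 * b + 5"
  by (simp add: middle_bound_def power2_eq_square power3_eq_cube field_simps)

text \<open>
The quadratic equation for \<^const>\<open>b_opt\<close> reduces the cubic to a linear expression, in which rational
bounds on \<^const>\<open>b_opt\<close> give the decimals of the error.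
\<close>

lemma middle_bound_b_opt: "middle_bound b_opt = (329 - 194 * b_opt) / 3240"
proof -
  have "3240 * middle_bound b_opt = 329 - 194 * b_opt"
    using middle_bound_expand[of b_opt] b_opt_root by algebra
  then show ?thesis by simp
qed

text \<open>
The difference is a cubic in \<open>b\<close> with a double root at the critical point \<^const>\<open>b_opt\<close>; its third root
is \<open>19 / 8 - 2 * b_opt\<close>, which is negative.
\<close>

lemma middle_bound_minimal:
  assumes "0 \<le> b"
  shows "middle_bound b_opt \<le> middle_bound b"
proof -
  have "135 * middle_bound b = 135 * middle_bound b_opt + 3 * (b - b_opt)\<^sup>2 * (8 * b + 16 * b_opt - 19)"
    using b_opt_root unfolding middle_bound_expand by algebra
  moreover have "0 \<le> 8 * b + 16 * b_opt - 19" using assms b_opt_bounds by simp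
  then have "0 \<le> 3 * (b - b_opt)\<^sup>2 * (8 * b + 16 * b_opt - 19)" by simp
  ultimately show ?thesis by linarith
qed

lemma middle_bound_b_opt_bounds: "0.02956945 < middle_bound b_opt" "middle_bound b_opt < 0.0295695"
  using b_opt_bounds by (simp_all add: middle_bound_b_opt)

section \<open>The lower bound\<close>

text \<open>
On [1,2] the points \<open>a\<close> and \<open>b\<close> do no better than the endpoint 1, so the bound for one prescribed
endpoint and one free point applies with \<open>L = 1\<close> and weight 4/5.
\<close>

lemma mix_distortion3_ge_one_right:
  assumes "a \<le> b" "b \<le> c" "b \<le> 1"
  shows "4/135 \<le> mix_distortion3 a b c"
proof -
  have "1 / 27 \<le> integral {1..2} (\<lambda>x. min ((x - 1)\<^sup>2) ((x - max 1 c)\<^sup>2))"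
    using integral_min_left_end_ge[of 1 2 "max 1 c"] by simp
  also have "\<dots> \<le> integral {1..2} (min_sq a b c)"
  proof (intro integral_le integrable_min_sq integrable_min2)
    fix x :: real assume x: "x \<in> {1..2}"
    have "(x - 1)\<^sup>2 \<le> (x - a)\<^sup>2" "(x - 1)\<^sup>2 \<le> (x - b)\<^sup>2"
      using assms x by (auto intro!: power_mono)
    moreover have "min ((x - 1)\<^sup>2) ((x - max 1 c)\<^sup>2) \<le> (x - c)\<^sup>2"
      using x by (cases "1 \<le> c") (auto intro!: min.coboundedI1 power_mono)
    ultimately show "min ((x - 1)\<^sup>2) ((x - max 1 c)\<^sup>2) \<le> min_sq a b c x"
      by (simp add: min_sq_def min.coboundedI1)
  qed
  finally have "1 / 27 \<le> integral {1..2} (min_sq a b c)" .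
  moreover have "0 \<le> integral {0..1} (min_sq a b c)"
    by (intro integral_nonneg integrable_min_sq) (auto simp: min_sq_def)
  ultimately show ?thesis by (simp add: mix_distortion3_def)
qed

text \<open>
The integral over [0,1] is that over [0,b] less the part over [1,b], which is known exactly because
the midpoint hypothesis makes \<open>b\<close> the nearest point there. This makes the integral over [1,b] enter
with the net weight 4/5 - 1/5 = 3/5.
\<close>

lemma mix_distortion3_ge_middle_bound:
  assumes "a \<le> b" "b \<le> c" "1 \<le> b" "b \<le> 2" and mid: "(a + b) / 2 \<le> 1"
  shows "middle_bound b \<le> mix_distortion3 a b c"
proof -
  have "b^3 / 27 \<le> integral {0..b} (\<lambda>x. min ((x - a)\<^sup>2) ((x - b)\<^sup>2))"
    using integral_min_right_end_ge[of 0 b a] assms by simp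
  also have "\<dots> = integral {0..1} (\<lambda>x. min ((x - a)\<^sup>2) ((x - b)\<^sup>2))
                + integral {1..b} (\<lambda>x. min ((x - a)\<^sup>2) ((x - b)\<^sup>2))"
    using assms
    by (intro Henstock_Kurzweil_Integration.integral_combine[symmetric] integrable_min2) auto
  also have "integral {1..b} (\<lambda>x. min ((x - a)\<^sup>2) ((x - b)\<^sup>2)) = integral {1..b} (\<lambda>x. (x - b)\<^sup>2)"
    using assms by (intro integral_cong min_absorb2 square_dist_le_midpoint(2)) auto
  also have "integral {1..b} (\<lambda>x. (x - b)\<^sup>2) = (b - 1)^3 / 3"
    using assms by (simp add: integral_square_dist power3_eq_cube algebra_simps)
  also have "integral {0..1} (\<lambda>x. min ((x - a)\<^sup>2) ((x - b)\<^sup>2)) = integral {0..1} (min_sq a b c)"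
  proof (rule integral_cong)
    fix x :: real assume "x \<in> {0..1}"
    then have "(x - b)\<^sup>2 \<le> (x - c)\<^sup>2"
      using assms by (intro square_dist_le_midpoint(1)) auto
    then show "min ((x - a)\<^sup>2) ((x - b)\<^sup>2) = min_sq a b c x" by (simp add: min_sq_def)
  qed
  finally have left: "b^3 / 27 - (b - 1)^3 / 3 \<le> integral {0..1} (min_sq a b c)" by simp
  have "integral {1..b} (min_sq a b c) = integral {1..b} (\<lambda>x. (x - b)\<^sup>2)"
  proof (rule integral_cong)
    fix x :: real assume "x \<in> {1..b}"
    then have "(x - b)\<^sup>2 \<le> (x - c)\<^sup>2" "(x - b)\<^sup>2 \<le> (x - a)\<^sup>2"
      using assms by (auto intro: square_dist_le_midpoint)
    then show "min_sq a b c x = (x - b)\<^sup>2" by (simp add: min_sq_def)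
  qed
  also have "\<dots> = (b - 1)^3 / 3"
    using assms by (simp add: integral_square_dist power3_eq_cube algebra_simps)
  finally have middle: "integral {1..b} (min_sq a b c) = (b - 1)^3 / 3" .
  have "(2 - b)^3 / 27 \<le> integral {b..2} (\<lambda>x. min ((x - b)\<^sup>2) ((x - c)\<^sup>2))"
    using assms by (intro integral_min_left_end_ge) auto
  also have "\<dots> = integral {b..2} (min_sq a b c)"
  proof (rule integral_cong)
    fix x :: real assume "x \<in> {b..2}"
    then have "(x - b)\<^sup>2 \<le> (x - a)\<^sup>2"
      using assms by (intro square_dist_le_midpoint(2)) auto
    then show "min ((x - b)\<^sup>2) ((x - c)\<^sup>2) = min_sq a b c x" by (simp add: min_sq_def)
  qed
  finally have right: "(2 - b)^3 / 27 \<le> integral {b..2} (min_sq a b c)" .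
  show ?thesis
    using left middle right integral_min_sq_combine[of 1 b 2 a b c] assms
    unfolding mix_distortion3_def middle_bound_def by argo
qed

text \<open>
Here \<open>a\<close> serves [0,1+t] while \<open>b\<close> and \<open>c\<close> share [1+t,2]. At \<open>t = 0\<close> the best cost is
\<open>1/60 + 1/60 = 1/30\<close>, and raising \<open>t\<close> burdens the cell of \<open>a\<close> by more than it relieves the other
two: its cost grows by at least \<open>t / 10\<close>, from the conflict between the centres of [0,1] and
[1,1+t], while theirs falls by at most \<open>t / 20\<close>.
\<close>

lemma mix_distortion3_ge_left_cell_beyond_1:
  assumes "a \<le> b" "b \<le> c" "b \<le> 2" and mid: "1 \<le> (a + b) / 2"
  shows "1/30 \<le> mix_distortion3 a b c"
proof -
  define t where "t = (a + b) / 2 - 1"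
  define d where "d = a - 1/2"
  have t: "0 \<le> t" "t \<le> 1" using assms by (auto simp: t_def)
  have a_nearest: "min_sq a b c x = (x - a)\<^sup>2" if "x \<le> 1 + t" for x
  proof -
    have "(x - a)\<^sup>2 \<le> (x - b)\<^sup>2" "(x - a)\<^sup>2 \<le> (x - c)\<^sup>2"
      using assms that by (auto intro!: square_dist_le_midpoint(1) simp: t_def)
    then show ?thesis by (simp add: min_sq_def)
  qed
  have "integral {0..1} (min_sq a b c) = integral {0..1} (\<lambda>x. (x - a)\<^sup>2)"
    using t by (intro integral_cong a_nearest) auto
  also have "\<dots> = 1/12 + d\<^sup>2"
    by (simp only: integral_square_dist[OF zero_le_one] d_def)
       (simp add: power2_eq_square power3_eq_cube field_simps)
  finally have left: "integral {0..1} (min_sq a b c) = 1/12 + d\<^sup>2" .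
  have "integral {1..1+t} (min_sq a b c) = integral {1..1+t} (\<lambda>x. (x - a)\<^sup>2)"
    using t by (intro integral_cong a_nearest) auto
  also have "\<dots> = t^3 / 12 + t * (d - (1 + t) / 2)\<^sup>2"
  proof -
    have "1 \<le> 1 + t" using t by simp
    then show ?thesis
      by (simp only: integral_square_dist[OF \<open>1 \<le> 1 + t\<close>] d_def)
         (simp add: power2_eq_square power3_eq_cube field_simps)
  qed
  finally have middle: "integral {1..1+t} (min_sq a b c) = t^3 / 12 + t * (d - (1 + t) / 2)\<^sup>2" .
  have "(2 - (1 + t))^3 / 48 \<le> integral {1+t..2} (\<lambda>x. min ((x - b)\<^sup>2) ((x - c)\<^sup>2))"
    using assms t by (intro integral_min_two_free_ge) auto
  also have "\<dots> = integral {1+t..2} (min_sq a b c)"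
  proof (rule integral_cong)
    fix x :: real assume "x \<in> {1+t..2}"
    then have "(x - b)\<^sup>2 \<le> (x - a)\<^sup>2"
      using assms by (intro square_dist_le_midpoint(2)) (auto simp: t_def)
    then show "min ((x - b)\<^sup>2) ((x - c)\<^sup>2) = min_sq a b c x" by (simp add: min_sq_def)
  qed
  finally have right: "(1 - t)^3 / 48 \<le> integral {1+t..2} (min_sq a b c)" by simp
  \<comment> \<open>Completing the square in \<open>d\<close>: the weighted mean of the two centres minimises the left part.\<close>
  have "t / 2 \<le> d\<^sup>2 + 4 * t * (d - (1 + t) / 2)\<^sup>2"
  proof -
    have "(1 + 4 * t) * (d\<^sup>2 + 4 * t * (d - (1 + t) / 2)\<^sup>2 - t / 2)
        = ((1 + 4 * t) * d - 2 * t * (1 + t))\<^sup>2 + t * (1/2 + t\<^sup>2)"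
      by (simp add: power2_eq_square field_simps)
    also have "\<dots> \<ge> 0" using t by simp
    finally show ?thesis using t by (simp add: zero_le_mult_iff)
  qed
  moreover have "2 - 6 * t \<le> 1 + 4 * t^3 + (1 - t)^3"
  proof -
    have "1 + 4 * t^3 + (1 - t)^3 - (2 - 6 * t) = 3 * t + 3 * t\<^sup>2 + 3 * t^3"
      by (simp add: power2_eq_square power3_eq_cube algebra_simps)
    also have "\<dots> \<ge> 0" using t by simp
    finally show ?thesis by simp
  qed
  ultimately show ?thesis
    using left middle right integral_min_sq_combine[of 1 "1 + t" 2 a b c] t
    unfolding mix_distortion3_def by argo
qed

lemma mix_distortion3_clamp:
  "mix_distortion3 (min a 2) (min b 2) (min c 2) \<le> mix_distortion3 a b c"
proof -
  have clamp: "(x - min y 2)\<^sup>2 \<le> (x - y)\<^sup>2" if "x \<le> 2" for x y :: real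
    using that square_dist_le_midpoint(1)[of 2 y x] by (cases "y \<le> 2") auto
  have "integral {l..r} (min_sq (min a 2) (min b 2) (min c 2)) \<le> integral {l..r} (min_sq a b c)"
    if "r \<le> 2" for l r
    using that
    unfolding min_sq_def
    by (intro integral_le integrable_continuous_real continuous_intros min.mono clamp) auto
  from this[of 1 0] this[of 2 1] show ?thesis
    by (simp add: mix_distortion3_def)
qed

lemma mix_distortion3_ge:
  assumes "a \<le> b" "b \<le> c"
  shows "middle_bound b_opt \<le> mix_distortion3 a b c"
proof -
  define a' b' c' where "a' = min a 2" and "b' = min b 2" and "c' = min c 2"
  have le: "a' \<le> b'" "b' \<le> c'" "b' \<le> 2"
    using assms by (auto simp: a'_def b'_def c'_def)
  have "middle_bound b_opt \<le> mix_distortion3 a' b' c'"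
  proof -
    consider "b' \<le> 1" | "1 \<le> b'" "(a' + b') / 2 \<le> 1" | "1 \<le> (a' + b') / 2" by linarith
    then show ?thesis
    proof cases
      case 1
      then show ?thesis
        using mix_distortion3_ge_one_right[of a' b' c'] le middle_bound_b_opt_bounds by simp
    next
      case 2
      then show ?thesis
        using mix_distortion3_ge_middle_bound[of a' b' c'] le middle_bound_minimal[of b'] by simp
    next
      case 3
      then show ?thesis
        using mix_distortion3_ge_left_cell_beyond_1[of a' b' c'] le middle_bound_b_opt_bounds by simp
    qed
  qed
  also have "\<dots> \<le> mix_distortion3 a b c"
    unfolding a'_def b'_def c'_def by (rule mix_distortion3_clamp)
  finally show ?thesis .
qed

section \<open>Attainment and conclusion\<close>

text \<open>
It suffices to assign each part of [0,2] to one of the points, since any assignment bounds the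
minimum from above. The cut points \<open>u\<close> and \<open>v\<close> are the midpoints of neighbouring points. Every half-cell
to the left of \<open>b\<close> has width \<open>p = b / 3\<close> and every one to the right has width \<open>q = (2 - b) / 3\<close>; the
further cut at 1 is where the density changes.
\<close>

lemma mix_distortion3_optimal_le:
  "mix_distortion3 (b_opt / 3) b_opt ((b_opt + 4) / 3) \<le> middle_bound b_opt"
proof -
  let ?b = b_opt
  let ?f = "min_sq (?b / 3) ?b ((?b + 4) / 3)"
  define u v where "u = 2 * ?b / 3" and "v = 2 * (?b + 1) / 3"
  have uv: "0 \<le> u" "u \<le> 1" "1 \<le> v" "v \<le> 2"
    using b_opt_bounds by (auto simp: u_def v_def)
  have cell: "integral {l..r} ?f \<le> ((r - z)^3 - (l - z)^3) / 3"
    if "l \<le> r" "z \<in> {?b / 3, ?b, (?b + 4) / 3}" for l r z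
  proof -
    have "integral {l..r} ?f \<le> integral {l..r} (\<lambda>x. (x - z)\<^sup>2)"
      using that(2) by (intro integral_le integrable_min_sq integrable_sq min_sq_le)
    then show ?thesis using that(1) by (simp add: integral_square_dist)
  qed
  define p q where "p = ?b / 3" and "q = (2 - ?b) / 3"
  have "integral {0..u} ?f \<le> 2 * p^3 / 3"
    using cell[of 0 u "?b / 3"] uv by (simp add: u_def p_def)
  moreover have "integral {u..1} ?f \<le> ((1 - ?b)^3 + p^3) / 3"
    using cell[of u 1 ?b] uv by (simp add: u_def p_def)
  moreover have "integral {1..v} ?f \<le> (q^3 - (1 - ?b)^3) / 3"
  proof -
    have "v - ?b = q" by (simp add: v_def q_def field_simps)
    then show ?thesis using cell[of 1 v ?b] uv by simp
  qed
  moreover have "integral {v..2} ?f \<le> 2 * q^3 / 3"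
  proof -
    have "2 - (?b + 4) / 3 = q" "v - (?b + 4) / 3 = - q" by (simp_all add: v_def q_def field_simps)
    then show ?thesis using cell[of v 2 "(?b + 4) / 3"] uv by simp
  qed
  moreover have "middle_bound ?b = p^3 / 5 - (1 - ?b)^3 / 5 + 4/5 * q^3"
  proof -
    have "(?b - 1)^3 = - ((1 - ?b)^3)" by (simp add: power3_eq_cube algebra_simps)
    then show ?thesis by (simp add: middle_bound_def p_def q_def power_divide)
  qed
  moreover have "integral {0..1} ?f = integral {0..u} ?f + integral {u..1} ?f"
    "integral {1..2} ?f = integral {1..v} ?f + integral {v..2} ?f"
    using uv by (auto intro: integral_min_sq_combine)
  ultimately show ?thesis unfolding mix_distortion3_def by argo
qed

lemma card_le_3_as_sorted_triple:
  fixes A :: "'a::linorder set"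
  assumes "1 \<le> card A" "card A \<le> 3"
  obtains a b c where "a \<le> b" "b \<le> c" "A = {a, b, c}"
proof -
  have fin: "finite A" and "A \<noteq> {}" using assms(1) by (auto intro: card_ge_0_finite)
  define a c where "a = Min A" and "c = Max A"
  have ac: "a \<in> A" "c \<in> A" "\<And>x. x \<in> A \<Longrightarrow> a \<le> x \<and> x \<le> c"
    using fin \<open>A \<noteq> {}\<close> by (auto simp: a_def c_def)
  have "\<exists>b\<in>A. A = {a, b, c}"
  proof (cases "A \<subseteq> {a, c}")
    case True
    then show ?thesis using ac by (intro bexI[of _ a]) auto
  next
    case False
    then obtain b where b: "b \<in> A" "b \<noteq> a" "b \<noteq> c" by blast
    then have "a \<noteq> c" using ac(3)[OF b(1)] by auto
    then have "card {a, b, c} = 3" using b by simp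
    then have "{a, b, c} = A"
      using ac b assms(2) fin by (intro card_seteq) auto
    then show ?thesis using b by auto
  qed
  then show thesis using that ac by blast
qed

lemma optimal_three_means:
  shows "quantization_error P_mix 3 = ennreal (middle_bound b_opt)"
    and "optimal_set_of_means P_mix 3 {b_opt / 3, b_opt, (b_opt + 4) / 3}"
proof -
  let ?A = "{b_opt / 3, b_opt, (b_opt + 4) / 3}"
  have card: "1 \<le> card ?A" "card ?A \<le> 3"
    by (auto simp: card_insert_if)
  have upper: "distortion P_mix ?A \<le> ennreal (middle_bound b_opt)"
    unfolding distortion_P_mix by (intro ennreal_leI mix_distortion3_optimal_le)
  have "ennreal (middle_bound b_opt) \<le> quantization_error P_mix 3"
    unfolding quantization_error_def
  proof (rule INF_greatest, clarify)
    fix \<alpha> :: "real set"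
    assume "1 \<le> card \<alpha>" "card \<alpha> \<le> 3"
    then obtain a b c where "a \<le> b" "b \<le> c" "\<alpha> = {a, b, c}"
      by (rule card_le_3_as_sorted_triple)
    then show "ennreal (middle_bound b_opt) \<le> distortion P_mix \<alpha>"
      by (simp add: distortion_P_mix ennreal_leI mix_distortion3_ge)
  qed
  moreover have "quantization_error P_mix 3 \<le> distortion P_mix ?A"
    unfolding quantization_error_def using card by (intro INF_lower) simp
  ultimately show "quantization_error P_mix 3 = ennreal (middle_bound b_opt)"
    and "optimal_set_of_means P_mix 3 ?A"
    using upper card by (auto simp: optimal_set_of_means_def)
qed

theorem proposition2p8p2:
  shows "\<exists>a1 a2 a3 :: real. a1 < a2 \<and> a2 < a3 \<and>
      optimal_set_of_means P_mix 3 {a1, a2, a3} \<and>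
      round (10 ^ 6 * a1) = 400679 \<and>
      round (10 ^ 6 * a2) = 1202036 \<and>
      round (10 ^ 6 * a3) = 1734012 \<and>
      round (10 ^ 7 * enn2real (quantization_error P_mix 3)) = 295695"
proof (intro exI conjI)
  show "b_opt / 3 < b_opt" "b_opt < (b_opt + 4) / 3"
    using b_opt_bounds by simp_all
  show "optimal_set_of_means P_mix 3 {b_opt / 3, b_opt, (b_opt + 4) / 3}"
    by (rule optimal_three_means)
  show "round (10 ^ 6 * (b_opt / 3)) = 400679" "round (10 ^ 6 * b_opt) = 1202036"
    "round (10 ^ 6 * ((b_opt + 4) / 3)) = 1734012"
    using b_opt_bounds by (auto intro!: round_unique simp: field_simps)
  show "round (10 ^ 7 * enn2real (quantization_error P_mix 3)) = 295695"
    using middle_bound_b_opt_bounds by (auto intro!: round_unique simp: optimal_three_means(1))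
qed

end
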